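(* Let $G$ be a finite simple undirected graph with Laplacian matrix $L_G$, and let $\{a,b\}$ and $\{c,d\}$ be two pairs of distinct vertices of $G$. Then $G$ has Laplacian pretty good pair state transfer from $\{a,b\}$ to $\{c,d\}$ if and only if the following two conditions hold: (1) $\mathbf{e}_a-\mathbf{e}_b$ and $\mathbf{e}_c-\mathbf{e}_d$ are Laplacian strongly cospectral; (2) whenever there are integers $\{l_i\}$ (indexed by the eigenvalues $\lambda_i\in\Lambda^{+}_{ab,cd}$) and $\{m_j\}$ (indexed by the eigenvalues $\mu_j\in\Lambda^{-}_{ab,cd}$) such that $$\sum_{\lambda_i\in\Lambda^{+}_{ab,cd}} l_i\lambda_i+\sum_{\mu_j\in\Lambda^{-}_{ab,cd}} m_j\mu_j=0 \quad\text{and}\quad \sum_i l_i+\sum_j m_j=0,$$ the integer $\sum_j m_j$ is even.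
   Context: $L_G=D_G-A_G$, where $A_G$ is the adjacency matrix and $D_G$ the diagonal degree matrix. $\mathbf{e}_u$ denotes the standard unit vector at vertex $u$. The transition matrix is $U_{L_G}(t)=\exp(-\mathrm{i}tL_G)$, $t\in\mathbb{R}$. $G$ has Laplacian pretty good pair state transfer (Pair-LPGST) from $\{a,b\}$ to $\{c,d\}$ if for every $\epsilon>0$ there exist $\tau\in\mathbb{R}$ and $\gamma\in\mathbb{C}$ with $|\gamma|=1$ such that $\left|U_{L_G}(\tau)(\mathbf{e}_a-\mathbf{e}_b)-\gamma(\mathbf{e}_c-\mathbf{e}_d)\right|<\epsilon$ (Euclidean norm). For an eigenvalue $\theta$ of $L_G$, $F_\theta$ denotes the eigenprojector, i.e. the orthogonal projection onto the $\theta$-eigenspace, so $L_G=\sum_\theta \theta F_\theta$. The Laplacian eigenvalue support $\mathrm{supp}_{L_G}(\mathbf{e}_a-\mathbf{e}_b)$ is the set of eigenvalues $\theta$ with $F_\theta(\mathbf{e}_a-\mathbf{e}_b)\neq\mathbf{0}$. The pairs are Laplacian strongly cospectral if $F_\theta(\mathbf{e}_a-\mathbf{e}_b)=\pm F_\theta(\mathbf{e}_c-\mathbf{e}_d)$ for every eigenvalue $\theta$ of $L_G$. $\Lambda^{+}_{ab,cd}$ (resp. $\Lambda^{-}_{ab,cd}$) is the set of eigenvalues $\theta\in\mathrm{supp}_{L_G}(\mathbf{e}_a-\mathbf{e}_b)$ with $F_\theta(\mathbf{e}_a-\mathbf{e}_b)=F_\theta(\mathbf{e}_c-\mathbf{e}_d)$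 (resp. $=-F_\theta(\mathbf{e}_c-\mathbf{e}_d)$). *)

theory Defs
  imports "HOL-Analysis.Analysis"
begin

(* A finite simple graph is a symmetric, irreflexive relation E on a finite type of vertices. *)

definition adjacency_matrix :: "('n::finite \<Rightarrow> 'n \<Rightarrow> bool) \<Rightarrow> real^'n^'n" where
  "adjacency_matrix E = (\<chi> i j. if E i j then 1 else 0)"

definition degree_matrix :: "('n::finite \<Rightarrow> 'n \<Rightarrow> bool) \<Rightarrow> real^'n^'n" where
  "degree_matrix E = (\<chi> i j. if i = j then real (card {k. E i k}) else 0)"

definition laplacian :: "('n::finite \<Rightarrow> 'n \<Rightarrow> bool) \<Rightarrow> real^'n^'n" where
  "laplacian E = degree_matrix E - adjacency_matrix E"

definition pair_vec :: "'n::finite \<Rightarrow> 'n \<Rightarrow> 'a::ring_1^'n" where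
  "pair_vec a b = axis a 1 - axis b 1"


(* The ring operations of HOL-Analysis on matrices are componentwise, so the overloaded
   power is not the matrix power, and matrices are no normed algebra to which the
   overloaded exp would apply. *)

primrec matpow :: "'a::semiring_1^'n::finite^'n \<Rightarrow> nat \<Rightarrow> 'a^'n^'n" where
  "matpow A 0 = mat 1"
| "matpow A (Suc k) = A ** matpow A k"

definition matexp :: "complex^'n::finite^'n \<Rightarrow> complex^'n^'n" where
  "matexp A = (\<Sum>k. matpow A k /\<^sub>R fact k)"

definition transition_matrix :: "real^'n::finite^'n \<Rightarrow> real \<Rightarrow> complex^'n^'n" where
  "transition_matrix M t = matexp (map_matrix (\<lambda>x. - \<i> * of_real t * of_real x) M)"

definition pair_lpgst ::
  "('n::finite \<Rightarrow> 'n \<Rightarrow> bool) \<Rightarrow> 'n \<Rightarrow> 'n \<Rightarrow> 'n \<Rightarrow> 'n \<Rightarrow> bool" where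
  "pair_lpgst E a b c d \<longleftrightarrow>
     (\<forall>\<epsilon>>0. \<exists>\<tau>::real. \<exists>\<gamma>::complex. norm \<gamma> = 1 \<and>
        norm (transition_matrix (laplacian E) \<tau> *v pair_vec a b - \<gamma> *s pair_vec c d) < \<epsilon>)"


definition eigenspace :: "real^'n::finite^'n \<Rightarrow> real \<Rightarrow> (real^'n) set" where
  "eigenspace M \<theta> = {v. M *v v = \<theta> *\<^sub>R v}"

definition eigenvalue :: "real^'n::finite^'n \<Rightarrow> real \<Rightarrow> bool" where
  "eigenvalue M \<theta> \<longleftrightarrow> (\<exists>v. v \<noteq> 0 \<and> M *v v = \<theta> *\<^sub>R v)"

definition orth_proj :: "'a::euclidean_space set \<Rightarrow> 'a \<Rightarrow> 'a" where
  "orth_proj S x = (THE y. y \<in> S \<and> (\<forall>w\<in>S. orthogonal (x - y) w))"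

definition eigenprojector :: "real^'n::finite^'n \<Rightarrow> real \<Rightarrow> real^'n \<Rightarrow> real^'n" where
  "eigenprojector M \<theta> = orth_proj (eigenspace M \<theta>)"

definition eigenvalue_support :: "real^'n::finite^'n \<Rightarrow> real^'n \<Rightarrow> real set" where
  "eigenvalue_support M u = {\<theta>. eigenvalue M \<theta> \<and> eigenprojector M \<theta> u \<noteq> 0}"

(* The sign may depend on the eigenvalue. *)
definition strongly_cospectral :: "real^'n::finite^'n \<Rightarrow> real^'n \<Rightarrow> real^'n \<Rightarrow> bool" where
  "strongly_cospectral M u v \<longleftrightarrow>
     (\<forall>\<theta>. eigenvalue M \<theta> \<longrightarrow>
        eigenprojector M \<theta> u = eigenprojector M \<theta> v \<or>
        eigenprojector M \<theta> u = - eigenprojector M \<theta> v)"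

definition Lambda_plus :: "real^'n::finite^'n \<Rightarrow> real^'n \<Rightarrow> real^'n \<Rightarrow> real set" where
  "Lambda_plus M u v =
     {\<theta> \<in> eigenvalue_support M u. eigenprojector M \<theta> u = eigenprojector M \<theta> v}"

definition Lambda_minus :: "real^'n::finite^'n \<Rightarrow> real^'n \<Rightarrow> real^'n \<Rightarrow> real set" where
  "Lambda_minus M u v =
     {\<theta> \<in> eigenvalue_support M u. eigenprojector M \<theta> u = - eigenprojector M \<theta> v}"


(* The definite description in orth_proj and the series in matexp are well-defined, and
   sums over sets of Laplacian eigenvalues are finite sums. *)

lemma orth_proj_ex1:
  fixes S :: "'a::euclidean_space set"
  assumes "subspace S"
  shows "\<exists>!y. y \<in> S \<and> (\<forall>w\<in>S. orthogonal (x - y) w)"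
proof -
  have S: "span S = S"
    using assms by (simp add: span_eq_iff)
  obtain y z where yz: "y \<in> S" "\<And>w. w \<in> S \<Longrightarrow> orthogonal z w" "x = y + z"
    using orthogonal_subspace_decomp_exists[of S x] unfolding S by blast
  show ?thesis
  proof (rule ex1I[of _ y])
    show "y \<in> S \<and> (\<forall>w\<in>S. orthogonal (x - y) w)"
      using yz by simp
  next
    fix y' assume y': "y' \<in> S \<and> (\<forall>w\<in>S. orthogonal (x - y') w)"
    have "y - y' \<in> S"
      using y' yz(1) assms by (simp add: subspace_diff)
    then have "(x - y') \<bullet> (y - y') = 0" "z \<bullet> (y - y') = 0"
      using y' yz(2) by (auto simp: orthogonal_def)
    then have "(y - y') \<bullet> (y - y') = 0"
      by (simp add: yz(3) algebra_simps)
    then show "y' = y" by simp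
  qed
qed

lemma subspace_eigenspace: "subspace (eigenspace M \<theta>)"
  by (auto simp: subspace_def eigenspace_def matrix_vector_right_distrib
      scaleR_right_distrib matrix_vector_mult_scaleR)

lemma orth_proj_unique:
  assumes "subspace S"
  shows "orth_proj S x = y \<longleftrightarrow> y \<in> S \<and> (\<forall>w\<in>S. orthogonal (x - y) w)"
  unfolding orth_proj_def using theI'[OF orth_proj_ex1[OF assms, of x]]
    orth_proj_ex1[OF assms, of x] by blast

lemma transpose_laplacian:
  assumes "symp E"
  shows "transpose (laplacian E) = laplacian E"
  using assms
  by (auto simp: transpose_def laplacian_def degree_matrix_def adjacency_matrix_def
      vec_eq_iff dest: sympD)

lemma finite_eigenvalues:
  fixes M :: "real^'n::finite^'n"
  assumes "transpose M = M"
  shows "finite {\<theta>. eigenvalue M \<theta>}"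
proof -
  let ?S = "{\<theta>. eigenvalue M \<theta>}"
  have "\<forall>\<theta>\<in>?S. \<exists>v. v \<noteq> 0 \<and> M *v v = \<theta> *\<^sub>R v"
    by (simp add: eigenvalue_def)
  then obtain f where "\<forall>\<theta>\<in>?S. f \<theta> \<noteq> 0 \<and> M *v f \<theta> = \<theta> *\<^sub>R f \<theta>"
    by (rule bchoice[THEN exE])
  then have f: "f \<theta> \<noteq> 0" "M *v f \<theta> = \<theta> *\<^sub>R f \<theta>" if "\<theta> \<in> ?S" for \<theta>
    using that by blast+
  have sym: "(M *v x) \<bullet> y = x \<bullet> (M *v y)" for x y
    using dot_lmul_matrix[of x M y] vector_transpose_matrix[of x M] assms by simp
  have orth: "f s \<bullet> f t = 0" if "s \<in> ?S" "t \<in> ?S" "s \<noteq> t" for s t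
  proof -
    have "s * (f s \<bullet> f t) = t * (f s \<bullet> f t)"
      using sym[of "f s" "f t"] f that by simp
    then show ?thesis using that by simp
  qed
  have "pairwise orthogonal (f ` ?S)"
    using orth by (auto simp: pairwise_def orthogonal_def)
  then have "finite (f ` ?S)"
    by (rule pairwise_orthogonal_imp_finite)
  moreover have "inj_on f ?S"
    using orth f(1) by (metis inj_onI inner_eq_zero_iff)
  ultimately show ?thesis
    by (rule finite_imageD)
qed

lemma summable_matexp:
  fixes A :: "complex^'n::finite^'n"
  shows "summable (\<lambda>k. matpow A k /\<^sub>R fact k)"
proof -
  define c where "c = (\<Sum>i\<in>UNIV. \<Sum>j\<in>UNIV. norm (A $ i $ j))"
  have row: "(\<Sum>j\<in>UNIV. norm (A $ i $ j)) \<le> c" for i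
    unfolding c_def by (rule member_le_sum) (auto intro: sum_nonneg)
  have c0: "0 \<le> c" unfolding c_def by (intro sum_nonneg) auto
  have bound: "norm (matpow A k $ i $ j) \<le> c ^ k" for k i j
  proof (induction k arbitrary: i)
    case 0
    show ?case by (simp add: mat_def)
  next
    case (Suc k)
    have "norm (matpow A (Suc k) $ i $ j) \<le> (\<Sum>l\<in>UNIV. norm (A $ i $ l) * c ^ k)"
      unfolding matpow.simps matrix_matrix_mult_def vec_lambda_beta
      by (rule sum_norm_le) (simp add: norm_mult Suc.IH mult_left_mono)
    also have "\<dots> \<le> c ^ Suc k"
      by (simp add: sum_distrib_right[symmetric] mult_right_mono row c0)
    finally show ?case .
  qed
  have "norm (matpow A k) \<le> (\<Sum>i\<in>(UNIV::'n set). \<Sum>j\<in>(UNIV::'n set). c ^ k)" for k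
  proof -
    have "norm (matpow A k) \<le> (\<Sum>i\<in>UNIV. norm (matpow A k $ i))"
      unfolding norm_vec_def by (rule L2_set_le_sum) auto
    also have "\<dots> \<le> (\<Sum>i\<in>UNIV. \<Sum>j\<in>UNIV. norm (matpow A k $ i $ j))"
      unfolding norm_vec_def[of "matpow A k $ _"] by (intro sum_mono L2_set_le_sum) auto
    also have "\<dots> \<le> (\<Sum>i\<in>(UNIV::'n set). \<Sum>j\<in>(UNIV::'n set). c ^ k)"
      by (intro sum_mono bound)
    finally show ?thesis .
  qed
  then have "norm (matpow A k /\<^sub>R fact k) \<le> real CARD('n) ^ 2 * (c ^ k /\<^sub>R fact k)" for k
    by (simp add: power2_eq_square divide_simps mult_ac)
  moreover have "summable (\<lambda>k. real CARD('n) ^ 2 * (c ^ k /\<^sub>R fact k))"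
    using summable_exp_generic[of c] by (intro summable_mult)
  ultimately show ?thesis
    by (rule summable_comparison_test'[rotated])
qed

end

theory Submission
  imports Defs
begin

text \<open>With \<open>u = e_a - e_b\<close> and \<open>v = e_c - e_d\<close>, the spectral theorem gives
  \<open>U(t) u = (\<Sum>\<theta>. exp(-\<i>t\<theta>) F_\<theta> u)\<close>, so transfer means that \<open>exp(-\<i>t\<theta>) F_\<theta> u\<close> is close to
  \<open>\<gamma> F_\<theta> v\<close> for all \<open>\<theta>\<close> simultaneously. Pairing with vectors of an eigenspace forces
  \<open>F_\<theta> u = \<plusminus>F_\<theta> v\<close>; then \<open>exp(-\<i>t\<theta>)/\<gamma>\<close> tends to the sign at \<open>\<theta>\<close>, and multiplying these limits
  along an integer relation yields the parity condition. Conversely, subtracting a fixed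
  \<open>\<theta>\<^sub>0\<close> from all the frequencies eliminates \<open>\<gamma>\<close>, and the parity condition becomes the solvability
  hypothesis of Kronecker's theorem for the frequencies \<open>\<theta> - \<theta>\<^sub>0\<close>.\<close>

section \<open>Kronecker approximation for dependent frequencies\<close>

text \<open>\<open>Kronecker_thm_1\<close> treats injective sequences whose image is independent
  over the integers; a bijection \<open>f\<close> from \<open>{..<card I}\<close> carries it over to
  finite families.\<close>

lemma Kronecker_independent:
  fixes \<theta> \<alpha> :: "'i \<Rightarrow> real"
  assumes "finite I" and "\<epsilon> > 0"
    and indep: "\<And>k::'i \<Rightarrow> int. (\<Sum>i\<in>I. of_int (k i) * \<theta> i) = 0 \<Longrightarrow> \<forall>i\<in>I. k i = 0"
  shows "\<exists>t h. \<forall>i\<in>I. \<bar>t * \<theta> i - of_int (h i) - \<alpha> i\<bar> < \<epsilon>"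
proof -
  interpret Z: Modules.module "\<lambda>r. (*) (real_of_int r)"
    by (simp add: Modules.module.intro distrib_left mult.commute)
  \<comment> \<open>Independence of the image, a mere set, cannot see repeated frequencies; the
    relation with coefficients 1 and -1 excludes them.\<close>
  have inj: "inj_on \<theta> I"
  proof (rule inj_onI, rule ccontr)
    fix i j assume ij: "i \<in> I" "j \<in> I" "\<theta> i = \<theta> j" "i \<noteq> j"
    define k :: "'i \<Rightarrow> int" where "k = (\<lambda>x. if x = i then 1 else if x = j then - 1 else 0)"
    have "(\<Sum>x\<in>I. of_int (k x) * \<theta> x) = (\<Sum>x\<in>{i, j}. of_int (k x) * \<theta> x)"
      using ij assms(1) by (intro sum.mono_neutral_right) (auto simp: k_def)
    also have "\<dots> = 0" using ij by (simp add: k_def)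
    finally show False using indep[of k] ij by (auto simp: k_def)
  qed
  obtain f where f: "bij_betw f {..<card I} I"
    using ex_bij_betw_nat_finite[OF assms(1)] by (auto simp: atLeast0LessThan)
  have img: "(\<theta> \<circ> f) ` {..<card I} = \<theta> ` I"
    using f by (metis bij_betw_imp_surj_on image_comp)
  have "\<not> Z.dependent (\<theta> ` I)"
  proof
    assume "Z.dependent (\<theta> ` I)"
    then obtain T u v where T: "finite T" "T \<subseteq> \<theta> ` I" "(\<Sum>v\<in>T. of_int (u v) * v) = 0"
        "v \<in> T" "u v \<noteq> 0"
      unfolding Z.dependent_explicit by blast
    \<comment> \<open>Pulled back along \<theta>, with default 0 off \<open>T\<close>, a dependence
      of the image becomes a relation of the family.\<close>
    define k where "k i = (if \<theta> i \<in> T then u (\<theta> i) else 0)" for i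
    have "(\<Sum>i\<in>I. of_int (k i) * \<theta> i) = (\<Sum>v\<in>\<theta> ` I. of_int (if v \<in> T then u v else 0) * v)"
      by (simp add: sum.reindex[OF inj] k_def)
    also have "\<dots> = (\<Sum>v\<in>T. of_int (u v) * v)"
      using T(2) assms(1) by (intro sum.mono_neutral_cong_right) auto
    finally have "\<forall>i\<in>I. k i = 0" using indep T(3) by simp
    moreover obtain i where "i \<in> I" "v = \<theta> i" using T by blast
    ultimately show False using T by (auto simp: k_def split: if_splits)
  qed
  moreover have "inj_on (\<theta> \<circ> f) {..<card I}"
    using f inj by (auto simp: bij_betw_def intro: comp_inj_on)
  ultimately obtain t h where
    th: "\<And>i. i < card I \<Longrightarrow> \<bar>t * (\<theta> \<circ> f) i - of_int (h i) - (\<alpha> \<circ> f) i\<bar> < \<epsilon>"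
    using Kronecker_thm_1[of "\<theta> \<circ> f" "card I" \<epsilon> "\<alpha> \<circ> f"] assms(2) unfolding img by metis
  have "\<bar>t * \<theta> i - of_int (h (inv_into {..<card I} f i)) - \<alpha> i\<bar> < \<epsilon>" if "i \<in> I" for i
    using th[of "inv_into {..<card I} f i"] f that
    by (metis bij_betw_def bij_betw_inv_into_right comp_apply inv_into_into lessThan_iff)
  then show ?thesis
    by (intro exI[of _ t] exI[of _ "\<lambda>i. h (inv_into {..<card I} f i)"]) blast
qed

text \<open>The substitution replacing \<open>\<theta> q\<close> by \<open>\<theta> q + s * \<theta> p\<close> is a unimodular change of
  frequencies; a Euclidean algorithm on the coefficients of an integer relation eventually
  makes one frequency vanish, so that it can be dropped.\<close>

theorem Kronecker_dependent:
  fixes \<theta> \<alpha> :: "'i \<Rightarrow> real"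
  assumes "finite I" and "\<epsilon> > 0"
    and "\<And>k::'i \<Rightarrow> int. (\<Sum>i\<in>I. of_int (k i) * \<theta> i) = 0 \<Longrightarrow> (\<Sum>i\<in>I. of_int (k i) * \<alpha> i) \<in> \<int>"
  shows "\<exists>t h. \<forall>i\<in>I. \<bar>t * \<theta> i - of_int (h i) - \<alpha> i\<bar> < \<epsilon>"
  using assms
proof (induction "card I" arbitrary: I \<theta> \<alpha> \<epsilon> rule: less_induct)
  case less
  note fin = less.prems(1) and smaller = less.hyps
  \<comment> \<open>The outer induction is on the number of frequencies. Given a nontrivial relation
    \<open>c\<close>, an inner induction on the sum of the absolute values of its coefficients
    changes frequencies, targets and tolerance, so all of these are generalised.\<close>
  have relation: "\<exists>t h. \<forall>i\<in>I. \<bar>t * \<theta> i - of_int (h i) - \<alpha> i\<bar> < \<epsilon>"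
    if "\<epsilon> > 0" "(\<Sum>i\<in>I. of_int (c i) * \<theta> i) = 0" "p \<in> I" "c p \<noteq> 0"
      "\<And>k::'i \<Rightarrow> int. (\<Sum>i\<in>I. of_int (k i) * \<theta> i) = 0 \<Longrightarrow> (\<Sum>i\<in>I. of_int (k i) * \<alpha> i) \<in> \<int>"
    for c :: "'i \<Rightarrow> int" and \<theta> \<alpha> :: "'i \<Rightarrow> real" and \<epsilon> p
    using that
  proof (induction "\<Sum>i\<in>I. nat \<bar>c i\<bar>" arbitrary: c \<theta> \<alpha> \<epsilon> p rule: less_induct)
    case (less c \<theta> \<alpha> \<epsilon> p)
    note step = less.hyps and rel = less.prems(2) and hyp = less.prems(5)
    show ?case
    proof (cases "\<exists>q\<in>I. q \<noteq> p \<and> c q \<noteq> 0")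
      \<comment> \<open>A single nonzero coefficient forces \<theta> p = 0, and the unit relation at
        \<open>p\<close> then makes \<alpha> p an integer.\<close>
      case False
      have sum_p: "(\<Sum>i\<in>I. of_int (k i) * f i) = of_int (k p) * f p"
        if "\<And>i. i \<in> I \<Longrightarrow> i \<noteq> p \<Longrightarrow> k i = 0" for k :: "'i \<Rightarrow> int" and f :: "'i \<Rightarrow> real"
        using that fin \<open>p \<in> I\<close> by (subst sum.remove[of _ p]) auto
      have \<theta>p: "\<theta> p = 0"
        using rel sum_p[of c \<theta>] False \<open>c p \<noteq> 0\<close> by auto
      have "\<alpha> p \<in> \<int>"
        using hyp[of "\<lambda>i. if i = p then 1 else 0"]
          sum_p[of "\<lambda>i. if i = p then 1 else 0"] \<theta>p by simp
      then obtain z where z: "\<alpha> p = of_int z" by (auto elim: Ints_cases)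
      \<comment> \<open>The hypothesis survives dropping \<open>p\<close>: a relation on the rest
        extends to \<open>I\<close>, and its value on \<alpha> changes only by the integer
        \<open>k p * z\<close>.\<close>
      have "(\<Sum>i\<in>I - {p}. of_int (k i) * \<alpha> i) \<in> \<int>"
        if "(\<Sum>i\<in>I - {p}. of_int (k i) * \<theta> i) = 0" for k :: "'i \<Rightarrow> int"
      proof -
        have "(\<Sum>i\<in>I. of_int (k i) * \<theta> i) = 0"
          using that fin \<open>p \<in> I\<close> \<theta>p by (subst sum.remove[of _ p]) auto
        from hyp[OF this] have "of_int (k p) * \<alpha> p + (\<Sum>i\<in>I - {p}. of_int (k i) * \<alpha> i) \<in> \<int>"
          using fin \<open>p \<in> I\<close> by (simp add: sum.remove[of _ p])
        then have "of_int (k p) * \<alpha> p + (\<Sum>i\<in>I - {p}. of_int (k i) * \<alpha> i) - of_int (k p * z) \<in> \<int>"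
          using Ints_diff Ints_of_int by blast
        then show ?thesis by (simp add: z)
      qed
      moreover have "card (I - {p}) < card I"
        using fin \<open>p \<in> I\<close> by (intro psubset_card_mono) auto
      ultimately obtain t h where "\<forall>i\<in>I - {p}. \<bar>t * \<theta> i - of_int (h i) - \<alpha> i\<bar> < \<epsilon>"
        using smaller[of "I - {p}" \<epsilon> \<theta> \<alpha>] fin \<open>0 < \<epsilon>\<close> by blast
      \<comment> \<open>As \<theta> p = 0, the choice \<open>- z\<close> makes the error at
        \<open>p\<close> exactly 0.\<close>
      then have "\<forall>i\<in>I. \<bar>t * \<theta> i - of_int ((h(p := - z)) i) - \<alpha> i\<bar> < \<epsilon>"
        using \<theta>p z \<open>0 < \<epsilon>\<close> by auto
      then show ?thesis by blast
    next
      case True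
      then obtain q where q: "q \<in> I" "q \<noteq> p" "c q \<noteq> 0" by blast
      \<comment> \<open>One Euclidean step: the larger coefficient, at \<open>x\<close>, is reduced
        by the smaller one, at \<open>y\<close>.\<close>
      have main: ?thesis
        if xy: "x \<in> I" "y \<in> I" "x \<noteq> y" "c x \<noteq> 0" "c y \<noteq> 0" "\<bar>c y\<bar> \<le> \<bar>c x\<bar>" for x y
      proof -
        \<comment> \<open>This sign gives \<open>s * c y\<close> the sign of \<open>c x\<close>, so
          that the subtraction shrinks the absolute value.\<close>
        define s where "s = sgn (c x) * sgn (c y)"
        have s: "\<bar>s\<bar> = 1" using xy by (simp add: s_def abs_mult abs_sgn_eq)
        define c' where "c' = c(x := c x - s * c y)"
        have c'x: "\<bar>c x - s * c y\<bar> < \<bar>c x\<bar>"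
          using xy by (auto simp: s_def sgn_if split: if_splits)
        define \<theta>' where "\<theta>' = \<theta>(y := \<theta> y + of_int s * \<theta> x)"
        define \<alpha>' where "\<alpha>' = \<alpha>(y := \<alpha> y + of_int s * \<alpha> x)"
        \<comment> \<open>Changing the value at \<open>y\<close> is dual to changing the coefficient
          at \<open>x\<close>. Hence relations and the integrality hypothesis pass between old and
          new frequencies.\<close>
        have shift: "(\<Sum>i\<in>I. of_int (k i) * (f(y := f y + of_int s * f x)) i)
            = (\<Sum>i\<in>I. of_int ((k(x := k x + s * k y)) i) * f i)"
          for k :: "'i \<Rightarrow> int" and f :: "'i \<Rightarrow> real"
        proof -
          have split: "sum g I = g x + g y + sum g (I - {x, y})" for g :: "'i \<Rightarrow> real"
          proof -
            have "sum g (I - {x}) = g y + sum g (I - {x} - {y})"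
              using xy fin by (intro sum.remove) auto
            moreover have "I - {x} - {y} = I - {x, y}" by blast
            ultimately show ?thesis
              using sum.remove[OF fin xy(1), of g] by (simp add: add.assoc)
          qed
          have "(\<Sum>i\<in>I - {x, y}. of_int (k i) * (f(y := f y + of_int s * f x)) i)
              = (\<Sum>i\<in>I - {x, y}. of_int ((k(x := k x + s * k y)) i) * f i)"
            by (intro sum.cong) auto
          then show ?thesis
            unfolding split using xy by (simp add: algebra_simps)
        qed
        have "(\<Sum>i\<in>I. nat \<bar>c' i\<bar>) < (\<Sum>i\<in>I. nat \<bar>c i\<bar>)"
          using xy c'x fin by (intro sum_strict_mono_ex1) (auto simp: c'_def)
        moreover have "(\<Sum>i\<in>I. of_int (c' i) * \<theta>' i) = 0"
          using rel xy unfolding \<theta>'_def shift c'_def by simp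
        moreover have "c' y \<noteq> 0" using xy by (simp add: c'_def)
        moreover have "(\<Sum>i\<in>I. of_int (k i) * \<alpha>' i) \<in> \<int>"
          if "(\<Sum>i\<in>I. of_int (k i) * \<theta>' i) = 0" for k :: "'i \<Rightarrow> int"
          using that hyp unfolding \<theta>'_def \<alpha>'_def shift by blast
        \<comment> \<open>The coefficient at \<open>x\<close> may now be 0, so \<open>y\<close> is
          the nonzero index handed to the induction. Half the tolerance suffices because undoing the
          substitution adds the errors at \<open>x\<close> and \<open>y\<close>.\<close>
        ultimately obtain t h where
          th: "\<forall>i\<in>I. \<bar>t * \<theta>' i - of_int (h i) - \<alpha>' i\<bar> < \<epsilon> / 2"
          using step[of c' "\<epsilon> / 2" \<theta>' y \<alpha>'] \<open>0 < \<epsilon>\<close> xy by auto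
        have eqx: "\<bar>t * \<theta> x - of_int (h x) - \<alpha> x\<bar> < \<epsilon> / 2"
          using th xy by (force simp: \<theta>'_def \<alpha>'_def)
        have "\<bar>(t * \<theta> y - of_int (h y - s * h x) - \<alpha> y)\<bar> < \<epsilon>"
        proof -
          have "t * \<theta> y - of_int (h y - s * h x) - \<alpha> y
              = (t * \<theta>' y - of_int (h y) - \<alpha>' y) - of_int s * (t * \<theta> x - of_int (h x) - \<alpha> x)"
            by (simp add: \<theta>'_def \<alpha>'_def algebra_simps)
          also have "\<bar>\<dots>\<bar> \<le> \<bar>t * \<theta>' y - of_int (h y) - \<alpha>' y\<bar>
              + \<bar>of_int s * (t * \<theta> x - of_int (h x) - \<alpha> x)\<bar>"
            by (rule abs_triangle_ineq4)
          also have "\<bar>of_int s * (t * \<theta> x - of_int (h x) - \<alpha> x)\<bar> = \<bar>t * \<theta> x - of_int (h x) - \<alpha> x\<bar>"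
            using s by (simp add: abs_mult flip: of_int_abs)
          finally show ?thesis using th xy eqx by fastforce
        qed
        then have "\<forall>i\<in>I. \<bar>t * \<theta> i - of_int ((h(y := h y - s * h x)) i) - \<alpha> i\<bar> < \<epsilon>"
          using th \<open>0 < \<epsilon>\<close> by (fastforce simp: \<theta>'_def \<alpha>'_def)
        then show ?thesis by blast
      qed
      show ?thesis
      proof (cases "\<bar>c q\<bar> \<le> \<bar>c p\<bar>")
        case True
        show ?thesis by (rule main[OF \<open>p \<in> I\<close> q(1) q(2)[symmetric] \<open>c p \<noteq> 0\<close> q(3) True])
      next
        case False
        then have le: "\<bar>c p\<bar> \<le> \<bar>c q\<bar>" by simp
        show ?thesis by (rule main[OF q(1) \<open>p \<in> I\<close> q(2) q(3) \<open>c p \<noteq> 0\<close> le])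
      qed
    qed
  qed
  show ?case
  proof (cases "\<forall>k::'i \<Rightarrow> int. (\<Sum>i\<in>I. of_int (k i) * \<theta> i) = 0 \<longrightarrow> (\<forall>i\<in>I. k i = 0)")
    case True
    then show ?thesis using Kronecker_independent[of I \<epsilon> \<theta> \<alpha>] less.prems by blast
  next
    case False
    then obtain k :: "'i \<Rightarrow> int" and p
      where "(\<Sum>i\<in>I. of_int (k i) * \<theta> i) = 0" "p \<in> I" "k p \<noteq> 0" by blast
    then show ?thesis using relation[OF less.prems(2) _ _ _ less.prems(3)] by blast
  qed
qed

section \<open>Spectral decomposition of real symmetric matrices\<close>

lemma symmetric_dot:
  fixes M :: "real^'n::finite^'n"
  assumes "transpose M = M"
  shows "(M *v x) \<bullet> y = x \<bullet> (M *v y)"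
  using dot_lmul_matrix[of x M y] vector_transpose_matrix[of x M] assms by simp

text \<open>A maximiser of the Rayleigh quotient on the unit sphere of \<open>S\<close> is an eigenvector.\<close>

lemma invariant_subspace_eigenvector:
  fixes M :: "real^'n::finite^'n"
  assumes sym: "transpose M = M" and S: "subspace S" "S \<noteq> {0}"
    and inv: "\<And>x. x \<in> S \<Longrightarrow> M *v x \<in> S"
  obtains v \<theta> where "v \<in> S" "v \<noteq> 0" "M *v v = \<theta> *\<^sub>R v"
proof -
  have comp: "compact (S \<inter> sphere 0 1)"
    using closed_subspace[OF S(1)] by (simp add: closed_Int_compact)
  obtain x where x: "x \<in> S" "x \<noteq> 0"
    using S subspace_0 by blast
  then have "x /\<^sub>R norm x \<in> S \<inter> sphere 0 1"
    using S(1) by (simp add: subspace_scale)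
  then have ne: "S \<inter> sphere 0 1 \<noteq> {}" by blast
  have "continuous_on (S \<inter> sphere 0 1) (\<lambda>x. x \<bullet> (M *v x))"
    by (intro continuous_intros linear_continuous_on) (simp add: linear_conv_bounded_linear[symmetric])
  from continuous_attains_sup[OF comp ne this] obtain v where
    v: "v \<in> S" "norm v = 1" and max: "\<And>y. y \<in> S \<Longrightarrow> norm y = 1 \<Longrightarrow> y \<bullet> (M *v y) \<le> v \<bullet> (M *v v)"
    by auto
  define \<theta> where "\<theta> = v \<bullet> (M *v v)"
  \<comment> \<open>Both sides are homogeneous of degree 2, so the bound extends from the unit
    sphere to all of \<open>S\<close>.\<close>
  have rayleigh: "y \<bullet> (M *v y) \<le> \<theta> * (y \<bullet> y)" if "y \<in> S" for y
  proof (cases "y = 0")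
    case False
    have "(y /\<^sub>R norm y) \<bullet> (M *v (y /\<^sub>R norm y)) \<le> \<theta>"
      unfolding \<theta>_def using False that S(1) by (intro max) (auto simp: subspace_scale)
    then have "(y \<bullet> (M *v y)) / (norm y)\<^sup>2 \<le> \<theta>"
      by (simp add: matrix_vector_mult_scaleR power2_eq_square divide_simps)
    then show ?thesis
      using False by (simp add: divide_simps power2_norm_eq_inner split: if_splits)
  qed simp
  \<comment> \<open>The residual \<open>w\<close> must vanish: otherwise moving \<open>v\<close>
    along \<open>w\<close> would raise the quotient to first order, against maximality.\<close>
  define w where "w = M *v v - \<theta> *\<^sub>R v"
  have w: "w \<in> S" unfolding w_def using v S(1) inv by (simp add: subspace_diff subspace_scale)
  define B where "B = w \<bullet> (M *v w) - \<theta> * (w \<bullet> w)"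
  have vv: "v \<bullet> v = 1" using v by (simp add: dot_square_norm)
  have quad: "2 * t * (w \<bullet> w) + t\<^sup>2 * B \<le> 0" for t
  proof -
    have "v + t *\<^sub>R w \<in> S" using v w S(1) by (simp add: subspace_add subspace_scale)
    from rayleigh[OF this] have
      "\<theta> + t * (v \<bullet> (M *v w)) + t * (w \<bullet> (M *v v)) + t * t * (w \<bullet> (M *v w))
        \<le> \<theta> * (1 + 2 * t * (v \<bullet> w) + t * t * (w \<bullet> w))"
      by (simp add: matrix_vector_right_distrib matrix_vector_mult_scaleR inner_add_left
          inner_add_right inner_commute[of w v] vv algebra_simps flip: \<theta>_def)
    moreover have "v \<bullet> (M *v w) = w \<bullet> (M *v v)"
      using symmetric_dot[OF sym, of v w] by (simp add: inner_commute)
    ultimately have "2 * t * (w \<bullet> (M *v v) - \<theta> * (v \<bullet> w)) + t\<^sup>2 * B \<le> 0"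
      by (simp add: B_def power2_eq_square algebra_simps)
    moreover have "w \<bullet> w = w \<bullet> (M *v v) - \<theta> * (v \<bullet> w)"
      unfolding w_def by (simp add: algebra_simps inner_commute)
    ultimately show ?thesis by (simp only:)
  qed
  have "w \<bullet> w = 0"
  proof (rule ccontr)
    assume "w \<bullet> w \<noteq> 0"
    then have pos: "w \<bullet> w > 0" by simp
    \<comment> \<open>So small that the quadratic term in \<open>quad\<close> cannot cancel the
      linear one.\<close>
    define t where "t = (w \<bullet> w) / (\<bar>B\<bar> + 1)"
    have t: "t > 0" using pos by (simp add: t_def)
    have "t * (2 * (w \<bullet> w) + t * B) \<le> 0"
      using quad[of t] by (simp add: power2_eq_square algebra_simps)
    then have "2 * (w \<bullet> w) + t * B \<le> 0"
      using t by (simp add: mult_le_0_iff)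
    moreover have "\<bar>t * B\<bar> \<le> w \<bullet> w"
      using pos by (simp add: t_def abs_mult divide_simps mult_left_mono)
    ultimately show False using pos by linarith
  qed
  then have "M *v v = \<theta> *\<^sub>R v" by (simp add: w_def)
  moreover have "v \<noteq> 0" using v by auto
  ultimately show ?thesis using that v by blast
qed

section \<open>Eigenprojectors and the spectral theorem\<close>

lemma eigenprojector_in_eigenspace: "eigenprojector M \<theta> x \<in> eigenspace M \<theta>"
  using orth_proj_unique[OF subspace_eigenspace] by (auto simp: eigenprojector_def)

lemma eigenprojector_dot:
  assumes "w \<in> eigenspace M \<theta>"
  shows "w \<bullet> eigenprojector M \<theta> x = w \<bullet> x"
proof -
  have "orthogonal (x - eigenprojector M \<theta> x) w"
    using orth_proj_unique[OF subspace_eigenspace, of M \<theta> x "orth_proj (eigenspace M \<theta>) x"] assms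
    by (simp add: eigenprojector_def)
  then show ?thesis by (simp add: orthogonal_def inner_diff_right inner_commute)
qed

lemma eigenspaces_orthogonal:
  assumes "transpose M = M" "x \<in> eigenspace M s" "y \<in> eigenspace M t" "s \<noteq> t"
  shows "x \<bullet> y = 0"
proof -
  have "s * (x \<bullet> y) = t * (x \<bullet> y)"
    using symmetric_dot[OF assms(1), of x y] assms(2,3) by (simp add: eigenspace_def)
  then show ?thesis using assms(4) by simp
qed

text \<open>Orthogonality of distinct eigenspaces leaves only the summand at \<theta>.\<close>

lemma eigenspace_dot_sum:
  fixes M :: "real^'n::finite^'n"
  assumes sym: "transpose M = M" and w: "w \<in> eigenspace M \<theta>" and ev: "eigenvalue M \<theta>"
  shows "(\<Sum>s | eigenvalue M s. w \<bullet> eigenprojector M s x) = w \<bullet> x"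
proof -
  have "(\<Sum>s | eigenvalue M s. w \<bullet> eigenprojector M s x)
      = (\<Sum>s\<in>{\<theta>}. w \<bullet> eigenprojector M s x)"
    using finite_eigenvalues[OF sym] ev
      eigenspaces_orthogonal[OF sym w eigenprojector_in_eigenspace]
    by (intro sum.mono_neutral_right) auto
  then show ?thesis using eigenprojector_dot[OF w] by simp
qed

text \<open>The vectors orthogonal to every eigenspace form an invariant subspace \<open>W\<close>.
  An eigenvector in \<open>W\<close> would be orthogonal to itself, so \<open>W\<close> is trivial,
  and it contains the difference of the two sides.\<close>

theorem spectral_decomposition:
  fixes M :: "real^'n::finite^'n"
  assumes sym: "transpose M = M"
  shows "(\<Sum>\<theta> | eigenvalue M \<theta>. eigenprojector M \<theta> x) = x"
proof -
  define W where "W = {y. \<forall>\<theta>. \<forall>w\<in>eigenspace M \<theta>. w \<bullet> y = 0}"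
  have "subspace W"
    by (auto simp: W_def subspace_def inner_add_right)
  moreover have "M *v y \<in> W" if "y \<in> W" for y
    using that symmetric_dot[OF sym] by (auto simp: W_def eigenspace_def simp flip: symmetric_dot[OF sym])
  moreover have "v = 0" if "v \<in> W" "M *v v = \<theta> *\<^sub>R v" for v \<theta>
  proof -
    have "v \<in> eigenspace M \<theta>" using that(2) by (simp add: eigenspace_def)
    then have "v \<bullet> v = 0" using that(1) unfolding W_def by blast
    then show ?thesis by simp
  qed
  ultimately have "W = {0}"
    using invariant_subspace_eigenvector[OF sym, of W] by metis
  moreover have "x - (\<Sum>\<theta> | eigenvalue M \<theta>. eigenprojector M \<theta> x) \<in> W"
  proof -
    have "w \<bullet> (x - (\<Sum>s | eigenvalue M s. eigenprojector M s x)) = 0"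
      if w: "w \<in> eigenspace M \<theta>" for w \<theta>
    proof (cases "w = 0")
      case False
      then have "eigenvalue M \<theta>" using w by (auto simp: eigenvalue_def eigenspace_def)
      then show ?thesis
        using eigenspace_dot_sum[OF sym w, of x] by (simp add: inner_diff_right inner_sum_right)
    qed simp
    then show ?thesis by (simp add: W_def)
  qed
  ultimately show ?thesis by simp
qed

section \<open>The transition matrix\<close>

text \<open>Complexification: eigenprojectors act on real vectors, transition matrices on complex
  ones.\<close>

definition cvec :: "real^'n::finite \<Rightarrow> complex^'n" where
  "cvec x = (\<chi> i. of_real (x $ i))"

lemma cvec_pair_vec: "cvec (pair_vec a b) = pair_vec a b"
  by (simp add: cvec_def pair_vec_def vec_eq_iff axis_def)

lemma cvec_sum: "cvec (\<Sum>i\<in>A. f i) = (\<Sum>i\<in>A. cvec (f i))"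
  by (simp add: cvec_def vec_eq_iff sum_component)

lemma cvec_scaleR: "cvec (r *\<^sub>R x) = of_real r *s cvec x"
  by (simp add: cvec_def vec_eq_iff)

lemma norm_cvec: "norm (cvec x) = norm x"
  by (simp add: cvec_def norm_vec_def)

lemma norm_vector_scalar_mult: "norm (z *s x) = norm z * norm (x :: 'a::real_normed_field^'n::finite)"
  by (simp add: norm_vec_def norm_mult L2_set_right_distrib)

definition cpair :: "real^'n::finite \<Rightarrow> complex^'n \<Rightarrow> complex" where
  "cpair w z = (\<Sum>i\<in>UNIV. of_real (w $ i) * z $ i)"

lemma cpair_cvec: "cpair w (cvec x) = of_real (w \<bullet> x)"
  by (simp add: cpair_def cvec_def inner_vec_def)

lemma cpair_scale: "cpair w (c *s x) = c * cpair w x"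
  by (simp add: cpair_def sum_distrib_left mult_ac)

lemma cpair_diff: "cpair w (x - y) = cpair w x - cpair w y"
  by (simp add: cpair_def right_diff_distrib sum_subtractf)

lemma cpair_sum: "cpair w (\<Sum>i\<in>A. f i) = (\<Sum>i\<in>A. cpair w (f i))"
  unfolding cpair_def sum_component sum_distrib_left by (rule sum.swap)

text \<open>Cauchy-Schwarz, applied to the absolute values of the entries.\<close>

lemma norm_cpair_le: "norm (cpair w z) \<le> norm w * norm z"
proof -
  have "norm (cpair w z) \<le> (\<Sum>i\<in>UNIV. \<bar>w $ i\<bar> * \<bar>norm (z $ i)\<bar>)"
    unfolding cpair_def by (rule sum_norm_le) (simp add: norm_mult)
  also have "\<dots> \<le> L2_set (\<lambda>i. w $ i) UNIV * L2_set (\<lambda>i. norm (z $ i)) UNIV"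
    by (rule L2_set_mult_ineq)
  finally show ?thesis by (simp add: norm_vec_def L2_set_def)
qed

section \<open>The matrix exponential on eigenvectors\<close>

lemma matpow_eigenvector:
  fixes A :: "complex^'n::finite^'n"
  assumes "A *v x = \<mu> *s x"
  shows "matpow A k *v x = \<mu> ^ k *s x"
proof (induction k)
  case (Suc k)
  have "matpow A (Suc k) *v x = A *v (matpow A k *v x)"
    by (simp add: matrix_vector_mul_assoc)
  also have "\<dots> = \<mu> ^ k *s (A *v x)"
    unfolding Suc by (simp add: vector_scalar_commute)
  finally show ?case by (simp add: assms vector_smult_assoc mult.commute)
qed simp

text \<open>Applying a matrix to \<open>x\<close> is bounded linear in the matrix, hence commutes
  with the exponential series, which becomes the scalar one.\<close>

lemma matexp_eigenvector:
  fixes A :: "complex^'n::finite^'n"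
  assumes "A *v x = \<mu> *s x"
  shows "matexp A *v x = exp \<mu> *s x"
proof -
  have "linear (\<lambda>A::complex^'n^'n. A *v x)"
    by (rule linearI) (simp_all add: matrix_vector_mult_def vec_eq_iff algebra_simps
        sum.distrib scaleR_sum_right)
  then have blA: "bounded_linear (\<lambda>A::complex^'n^'n. A *v x)"
    by (simp add: linear_conv_bounded_linear)
  have "linear (\<lambda>z::complex. z *s x)"
    by (rule linearI) (simp_all add: vec_eq_iff algebra_simps)
  then have blz: "bounded_linear (\<lambda>z::complex. z *s x)"
    by (simp add: linear_conv_bounded_linear)
  have "matexp A *v x = (\<Sum>k. (matpow A k /\<^sub>R fact k) *v x)"
    unfolding matexp_def by (rule bounded_linear.suminf[OF blA summable_matexp])
  also have "\<dots> = (\<Sum>k. (\<mu> ^ k /\<^sub>R fact k) *s x)"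
    by (simp add: linear_scale[OF bounded_linear.linear[OF blA]]
        linear_scale[OF bounded_linear.linear[OF blz]] matpow_eigenvector[OF assms])
  also have "\<dots> = exp \<mu> *s x"
    unfolding exp_def by (rule bounded_linear.suminf[OF blz summable_exp_generic, symmetric])
  finally show ?thesis .
qed

lemma transition_matrix_eigenvector:
  assumes "x \<in> eigenspace M \<theta>"
  shows "transition_matrix M t *v cvec x = cis (- t * \<theta>) *s cvec x"
proof -
  have "map_matrix (\<lambda>x. - \<i> * of_real t * of_real x) M *v cvec x
      = (- \<i> * of_real t) *s cvec (M *v x)"
    by (simp add: vec_eq_iff map_matrix_def cvec_def matrix_vector_mult_def sum_distrib_left
        sum_negf mult_ac)
  also have "M *v x = \<theta> *\<^sub>R x" using assms by (simp add: eigenspace_def)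
  finally have "map_matrix (\<lambda>x. - \<i> * of_real t * of_real x) M *v cvec x
      = (\<i> * of_real (- t * \<theta>)) *s cvec x"
    by (simp add: cvec_scaleR vector_smult_assoc mult_ac)
  from matexp_eigenvector[OF this] show ?thesis
    by (simp add: transition_matrix_def cis_conv_exp)
qed

lemma transition_matrix_spectral:
  fixes M :: "real^'n::finite^'n"
  assumes "transpose M = M"
  shows "transition_matrix M t *v cvec x
    = (\<Sum>\<theta> | eigenvalue M \<theta>. cis (- t * \<theta>) *s cvec (eigenprojector M \<theta> x))"
proof -
  have "transition_matrix M t *v cvec x
      = transition_matrix M t *v (\<Sum>\<theta> | eigenvalue M \<theta>. cvec (eigenprojector M \<theta> x))"
    by (simp add: spectral_decomposition[OF assms] flip: cvec_sum)
  also have "\<dots> = (\<Sum>\<theta> | eigenvalue M \<theta>. transition_matrix M t *v cvec (eigenprojector M \<theta> x))"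
    using sum_comp_morphism[of "(*v) (transition_matrix M t)" "\<lambda>\<theta>. cvec (eigenprojector M \<theta> x)"]
    by (simp add: matrix_vector_right_distrib o_def)
  finally show ?thesis
    by (simp add: transition_matrix_eigenvector[OF eigenprojector_in_eigenspace])
qed


section \<open>Pretty good state transfer between real vectors\<close>

text \<open>A chord of the unit circle is no longer than its arc; its length is twice the sine of
  half the angle.\<close>

lemma norm_cis_diff_le: "norm (cis x - cis y) \<le> \<bar>x - y\<bar>"
proof -
  have "cis x - cis y = cis y * (cis (x - y) - 1)"
    by (simp add: right_diff_distrib cis_mult)
  then have "norm (cis x - cis y) = 2 * \<bar>sin ((x - y) / 2)\<bar>"
    by (simp only: norm_mult norm_cis mult_1 cis_conv_exp[of "x - y"] dist_exp_i_1)
  also have "\<dots> \<le> \<bar>x - y\<bar>" using abs_sin_x_le_abs_x[of "(x - y) / 2"] by simp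
  finally show ?thesis .
qed

lemma prod_cis_powi:
  assumes "finite A"
  shows "(\<Prod>i\<in>A. cis (f i) powi k i) = cis (\<Sum>i\<in>A. of_int (k i) * f i)"
  using assms by (induction rule: finite_induct) (simp_all add: cis_power_int cis_mult)

text \<open>Yields one sign for the whole vector from a sign that may vary with \<open>w\<close>.
  The hypothesis says that \<open>w\<close> is orthogonal to \<open>p\<close> or to
  \<open>q\<close>; testing \<open>w = p\<close> gives that \<open>p\<close> and \<open>q\<close>
  are orthogonal, and \<open>w = p + q\<close> then kills one of them.\<close>

lemma eq_or_eq_minus_if_abs_inner_eq:
  assumes "subspace S" "x \<in> S" "y \<in> S" and eq: "\<And>w. w \<in> S \<Longrightarrow> \<bar>w \<bullet> x\<bar> = \<bar>w \<bullet> y\<bar>"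
  shows "x = y \<or> x = - y"
proof -
  define p q where "p = x - y" and "q = x + y"
  have prod: "(w \<bullet> p) * (w \<bullet> q) = 0" if "w \<in> S" for w
    using eq[OF that] by (auto simp: p_def q_def inner_diff_right inner_add_right abs_eq_iff)
  have S: "p \<in> S" "p + q \<in> S"
    using assms(1-3) by (auto simp: p_def q_def intro!: subspace_diff subspace_add)
  have "p \<bullet> q = 0"
    using prod[OF S(1)] by auto
  then have "(p + q) \<bullet> p = p \<bullet> p" "(p + q) \<bullet> q = q \<bullet> q"
    by (simp_all add: inner_add_left inner_commute[of q p])
  with prod[OF S(2)] have "p = 0 \<or> q = 0" by simp
  then show ?thesis by (auto simp: p_def q_def eq_neg_iff_add_eq_0)
qed

definition pretty_good_transfer :: "real^'n::finite^'n \<Rightarrow> real^'n \<Rightarrow> real^'n \<Rightarrow> bool" where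
  "pretty_good_transfer M u v \<longleftrightarrow>
     (\<forall>\<epsilon>>0. \<exists>\<tau>. \<exists>\<gamma>::complex. norm \<gamma> = 1 \<and>
        norm (transition_matrix M \<tau> *v cvec u - \<gamma> *s cvec v) < \<epsilon>)"

section \<open>Signs and phases on the eigenvalue support\<close>

locale symmetric_pair =
  fixes M :: "real^'n::finite^'n" and u v :: "real^'n"
  assumes sym: "transpose M = M"
begin

abbreviation "Lp \<equiv> Lambda_plus M u v"
abbreviation "Lm \<equiv> Lambda_minus M u v"

text \<open>The argument of the sign relating the two projections, so that
  \<open>cis (phase \<theta>)\<close> is that sign on the support.\<close>

definition phase :: "real \<Rightarrow> real" where
  "phase \<theta> = (if \<theta> \<in> Lm then pi else 0)"

lemma finite_Lambda: "finite Lp" "finite Lm"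
  by (rule finite_subset[OF _ finite_eigenvalues[OF sym]];
      auto simp: Lambda_plus_def Lambda_minus_def eigenvalue_support_def)+

text \<open>A vector equal to its own negative is 0, whereas projections of \<open>u\<close> are
  nonzero on the support.\<close>

lemma Lambda_disjoint: "Lp \<inter> Lm = {}"
proof -
  have "x = 0" if "x = y" "x = - y" for x y :: "real^'n"
  proof -
    have "2 *\<^sub>R x = 0" using that by (metis scaleR_2 eq_neg_iff_add_eq_0)
    then show ?thesis by simp
  qed
  then show ?thesis
    by (auto simp: Lambda_plus_def Lambda_minus_def eigenvalue_support_def)
qed

lemma Lambda_eigenvalue: "\<theta> \<in> Lp \<union> Lm \<Longrightarrow> eigenvalue M \<theta>"
  and Lambda_nonzero: "\<theta> \<in> Lp \<union> Lm \<Longrightarrow> eigenprojector M \<theta> u \<noteq> 0"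
  by (auto simp: Lambda_plus_def Lambda_minus_def eigenvalue_support_def)

lemma eigenprojector_phase:
  assumes "\<theta> \<in> Lp \<union> Lm"
  shows "eigenprojector M \<theta> v = cos (phase \<theta>) *\<^sub>R eigenprojector M \<theta> u"
  using assms Lambda_disjoint by (auto simp: phase_def Lambda_plus_def Lambda_minus_def)

lemma cis_phase: "cis (phase \<theta>) = of_real (cos (phase \<theta>))"
  by (simp add: phase_def)

text \<open>Merges two coefficient families into one; \<open>f\<close> is generic to cover both the
  weighted sum and the plain sum of coefficients.\<close>

lemma sum_Lambda:
  fixes f :: "int \<Rightarrow> real \<Rightarrow> 'a::comm_monoid_add"
  shows "(\<Sum>\<theta>\<in>Lp \<union> Lm. f (if \<theta> \<in> Lm then m \<theta> else l \<theta>) \<theta>)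
    = (\<Sum>x\<in>Lp. f (l x) x) + (\<Sum>y\<in>Lm. f (m y) y)"
  by (subst sum.union_disjoint[OF finite_Lambda Lambda_disjoint])
    (use Lambda_disjoint in \<open>auto intro!: arg_cong2[where f = "(+)"] sum.cong\<close>)

text \<open>Evaluated on phases, a relation produces the integer whose parity is at stake.\<close>

lemma sum_phase:
  "(\<Sum>\<theta>\<in>Lp \<union> Lm. of_int (k \<theta>) * phase \<theta>) = pi * of_int (\<Sum>y\<in>Lm. k y)"
proof -
  have "(\<Sum>\<theta>\<in>Lp \<union> Lm. of_int (k \<theta>) * phase \<theta>) = (\<Sum>y\<in>Lm. of_int (k y) * pi)"
    using finite_Lambda by (intro sum.mono_neutral_cong_right) (auto simp: phase_def)
  then show ?thesis by (simp add: sum_distrib_left mult.commute)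
qed

text \<open>Pairing with an eigenvector isolates a single frequency of the evolution.\<close>

lemma cpair_transfer:
  assumes w: "w \<in> eigenspace M \<theta>" and ev: "eigenvalue M \<theta>"
  shows "cpair w (transition_matrix M t *v cvec u - \<gamma> *s cvec v)
    = cis (- t * \<theta>) * of_real (w \<bullet> u) - \<gamma> * of_real (w \<bullet> v)"
proof -
  have "cpair w (transition_matrix M t *v cvec u)
      = (\<Sum>s | eigenvalue M s. cis (- t * s) * of_real (w \<bullet> eigenprojector M s u))"
    by (simp add: transition_matrix_spectral[OF sym] cpair_sum cpair_scale cpair_cvec)
  also have "\<dots> = (\<Sum>s\<in>{\<theta>}. cis (- t * s) * of_real (w \<bullet> eigenprojector M s u))"
    using finite_eigenvalues[OF sym] ev
      eigenspaces_orthogonal[OF sym w eigenprojector_in_eigenspace]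
    by (intro sum.mono_neutral_right) auto
  finally show ?thesis
    by (simp add: cpair_diff cpair_scale cpair_cvec eigenprojector_dot[OF w])
qed

text \<open>Both claims come from one sequence of times and phases with errors tending to 0, tested
  against eigenvectors.\<close>

lemma transfer_necessary:
  assumes "pretty_good_transfer M u v"
  shows "strongly_cospectral M u v"
    and "(\<Sum>\<theta>\<in>Lp \<union> Lm. of_int (k \<theta>) * \<theta>) = 0 \<Longrightarrow> (\<Sum>\<theta>\<in>Lp \<union> Lm. k \<theta>) = 0
      \<Longrightarrow> even (\<Sum>y\<in>Lm. k y)"
proof -
  have "\<forall>n. \<exists>\<tau> \<gamma>. norm \<gamma> = 1 \<and>
      norm (transition_matrix M \<tau> *v cvec u - \<gamma> *s cvec v) < inverse (real (Suc n))"
    using assms by (simp add: pretty_good_transfer_def)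
  then obtain \<tau> \<gamma> where \<gamma>: "\<And>n. norm (\<gamma> n) = 1" and
    approx: "\<And>n. norm (transition_matrix M (\<tau> n) *v cvec u - \<gamma> n *s cvec v)
      < inverse (real (Suc n))"
    by metis
  have lim: "(\<lambda>n. cis (- \<tau> n * \<theta>) * of_real (w \<bullet> u) - \<gamma> n * of_real (w \<bullet> v)) \<longlonglongrightarrow> 0"
    if w: "w \<in> eigenspace M \<theta>" "eigenvalue M \<theta>" for w \<theta>
  proof (rule Lim_null_comparison)
    show "\<forall>\<^sub>F n in sequentially. norm (cis (- \<tau> n * \<theta>) * of_real (w \<bullet> u) - \<gamma> n * of_real (w \<bullet> v))
        \<le> norm w * inverse (real (Suc n))"
      unfolding cpair_transfer[OF w, symmetric]
      using approx by (intro always_eventually allI order_trans[OF norm_cpair_le] mult_left_mono)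
        (auto intro: less_imp_le)
    show "(\<lambda>n. norm w * inverse (real (Suc n))) \<longlonglongrightarrow> 0"
      using tendsto_mult_right_zero[OF LIMSEQ_inverse_real_of_nat] .
  qed
  \<comment> \<open>Both coefficients in \<open>lim\<close> have modulus 1, so a constant sequence
    is dominated by a null sequence.\<close>
  have abs_eq: "\<bar>w \<bullet> u\<bar> = \<bar>w \<bullet> v\<bar>" if w: "w \<in> eigenspace M \<theta>" "eigenvalue M \<theta>" for w \<theta>
  proof -
    have "(\<lambda>n::nat. \<bar>w \<bullet> u\<bar> - \<bar>w \<bullet> v\<bar>) \<longlonglongrightarrow> 0"
    proof (rule Lim_null_comparison[OF _ tendsto_norm_zero[OF lim[OF w]]], intro always_eventually allI)
      show "norm (\<bar>w \<bullet> u\<bar> - \<bar>w \<bullet> v\<bar>)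
          \<le> norm (cis (- \<tau> n * \<theta>) * of_real (w \<bullet> u) - \<gamma> n * of_real (w \<bullet> v))" for n
        using norm_triangle_ineq3[of "cis (- \<tau> n * \<theta>) * of_real (w \<bullet> u)" "\<gamma> n * of_real (w \<bullet> v)"] \<gamma>[of n]
        by (simp add: norm_mult)
    qed
    then show ?thesis by (simp add: LIMSEQ_const_iff)
  qed
  show "strongly_cospectral M u v"
    unfolding strongly_cospectral_def
  proof (intro allI impI)
    fix \<theta> assume "eigenvalue M \<theta>"
    then show "eigenprojector M \<theta> u = eigenprojector M \<theta> v \<or>
        eigenprojector M \<theta> u = - eigenprojector M \<theta> v"
      by (intro eq_or_eq_minus_if_abs_inner_eq[OF subspace_eigenspace[of M \<theta>]])
        (simp_all add: eigenprojector_in_eigenspace eigenprojector_dot abs_eq)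
  qed
  assume rel: "(\<Sum>\<theta>\<in>Lp \<union> Lm. of_int (k \<theta>) * \<theta>) = 0" "(\<Sum>\<theta>\<in>Lp \<union> Lm. k \<theta>) = 0"
  define g where "g n = Arg (\<gamma> n)" for n
  have g: "\<gamma> n = cis (g n)" for n
    using \<gamma>[of n] rcis_cmod_Arg[of "\<gamma> n"] by (simp add: g_def rcis_def)
  have lim_phase: "(\<lambda>n. cis (- \<tau> n * \<theta> - g n)) \<longlonglongrightarrow> cis (phase \<theta>)" if \<theta>: "\<theta> \<in> Lp \<union> Lm" for \<theta>
  proof -
    \<comment> \<open>This test vector is nonzero and pairs with \<open>u\<close> and
      \<open>v\<close> to \<open>w \<bullet> w\<close> up to the sign, a factor that can be divided
      out.\<close>
    define w where "w = eigenprojector M \<theta> u"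
    have w: "w \<in> eigenspace M \<theta>" "w \<noteq> 0"
      using Lambda_nonzero[OF \<theta>] by (simp_all add: w_def eigenprojector_in_eigenspace)
    have "w \<bullet> u = w \<bullet> w" "w \<bullet> v = cos (phase \<theta>) * (w \<bullet> w)"
      using eigenprojector_dot[OF w(1)] eigenprojector_phase[OF \<theta>] by (simp_all add: w_def)
        (metis inner_scaleR_right)
    with lim[OF w(1) Lambda_eigenvalue[OF \<theta>]]
    have "(\<lambda>n. of_real (w \<bullet> w) * (cis (- \<tau> n * \<theta>) - \<gamma> n * cis (phase \<theta>))) \<longlonglongrightarrow> 0"
      by (simp add: cis_phase algebra_simps)
    then have lim0: "(\<lambda>n. cis (- \<tau> n * \<theta>) - \<gamma> n * cis (phase \<theta>)) \<longlonglongrightarrow> 0"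
      using w(2) by (simp add: tendsto_mult_left_iff)
    have "norm (cis (- \<tau> n * \<theta>) - \<gamma> n * cis (phase \<theta>))
        = norm (cis (- \<tau> n * \<theta> - g n) - cis (phase \<theta>))" for n
    proof -
      have "cis (- \<tau> n * \<theta>) - \<gamma> n * cis (phase \<theta>)
          = cis (g n) * (cis (- \<tau> n * \<theta> - g n) - cis (phase \<theta>))"
        by (simp add: g cis_mult right_diff_distrib)
      then show ?thesis by (simp only: norm_mult norm_cis mult_1)
    qed
    with tendsto_norm_zero[OF lim0]
    have "(\<lambda>n. norm (cis (- \<tau> n * \<theta> - g n) - cis (phase \<theta>))) \<longlonglongrightarrow> 0"
      by (simp only:)
    then show ?thesis by (rule LIM_zero_cancel[OF tendsto_norm_zero_cancel])
  qed
  have "(\<lambda>n. \<Prod>\<theta>\<in>Lp \<union> Lm. cis (- \<tau> n * \<theta> - g n) powi k \<theta>)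
      \<longlonglongrightarrow> (\<Prod>\<theta>\<in>Lp \<union> Lm. cis (phase \<theta>) powi k \<theta>)"
    by (intro tendsto_prod tendsto_power_int lim_phase) auto
  \<comment> \<open>The weighted relation cancels the time, the vanishing coefficient sum cancels
    the global phase \<open>g n\<close>.\<close>
  moreover have "(\<Prod>\<theta>\<in>Lp \<union> Lm. cis (- \<tau> n * \<theta> - g n) powi k \<theta>) = 1" for n
  proof -
    have "(\<Sum>\<theta>\<in>Lp \<union> Lm. of_int (k \<theta>) * (- \<tau> n * \<theta> - g n))
        = - \<tau> n * (\<Sum>\<theta>\<in>Lp \<union> Lm. of_int (k \<theta>) * \<theta>) - of_int (\<Sum>\<theta>\<in>Lp \<union> Lm. k \<theta>) * g n"
      unfolding sum_distrib_left of_int_sum sum_distrib_right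
      by (simp add: algebra_simps flip: sum_subtractf)
    then show ?thesis using finite_Lambda by (simp add: prod_cis_powi rel)
  qed
  moreover have "(\<Prod>\<theta>\<in>Lp \<union> Lm. cis (phase \<theta>) powi k \<theta>) = cis (pi * of_int (\<Sum>y\<in>Lm. k y))"
    using finite_Lambda by (simp add: prod_cis_powi sum_phase del: of_int_sum)
  ultimately have "cis (pi * of_int (\<Sum>y\<in>Lm. k y)) = 1"
    by (simp add: LIMSEQ_const_iff del: of_int_sum)
  then have "cos (pi * of_int (\<Sum>y\<in>Lm. k y)) = 1"
    by (simp add: complex_eq_iff del: of_int_sum)
  then show "even (\<Sum>y\<in>Lm. k y)"
    by (simp add: cos_npi_int del: of_int_sum split: if_splits)
qed

text \<open>Spectral expansion of both vectors reduces the error to scalar errors, one per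
  eigenvalue, combined by the triangle inequality.\<close>

lemma transfer_error_le:
  assumes "strongly_cospectral M u v"
    and "\<And>\<theta>. \<theta> \<in> Lp \<union> Lm \<Longrightarrow> norm (cis (- t * \<theta>) - \<gamma> * cis (phase \<theta>)) \<le> \<delta>"
  shows "norm (transition_matrix M t *v cvec u - \<gamma> *s cvec v)
    \<le> \<delta> * (\<Sum>\<theta>\<in>Lp \<union> Lm. norm (eigenprojector M \<theta> u))"
proof -
  have "cvec v = (\<Sum>\<theta> | eigenvalue M \<theta>. cvec (eigenprojector M \<theta> v))"
    using spectral_decomposition[OF sym, of v] by (metis cvec_sum)
  then have "transition_matrix M t *v cvec u - \<gamma> *s cvec v
      = (\<Sum>\<theta> | eigenvalue M \<theta>. cis (- t * \<theta>) *s cvec (eigenprojector M \<theta> u)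
          - \<gamma> *s cvec (eigenprojector M \<theta> v))"
    by (simp add: transition_matrix_spectral[OF sym] sum_subtractf vec.scale_sum_right)
  also have "\<dots> = (\<Sum>\<theta>\<in>Lp \<union> Lm. cis (- t * \<theta>) *s cvec (eigenprojector M \<theta> u)
          - \<gamma> *s cvec (eigenprojector M \<theta> v))"
  proof (rule sum.mono_neutral_right[OF finite_eigenvalues[OF sym]])
    show "\<forall>\<theta>\<in>{\<theta>. eigenvalue M \<theta>} - (Lp \<union> Lm).
        cis (- t * \<theta>) *s cvec (eigenprojector M \<theta> u) - \<gamma> *s cvec (eigenprojector M \<theta> v) = 0"
    proof
      fix \<theta> assume \<theta>: "\<theta> \<in> {\<theta>. eigenvalue M \<theta>} - (Lp \<union> Lm)"
      \<comment> \<open>Off the support the projection of \<open>u\<close> is 0, and strong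
        cospectrality makes that of \<open>v\<close> vanish too.\<close>
      then have "eigenprojector M \<theta> u = 0 \<and> eigenprojector M \<theta> v = 0"
        using assms(1) by (auto simp: strongly_cospectral_def Lambda_plus_def Lambda_minus_def
            eigenvalue_support_def)
      then show "cis (- t * \<theta>) *s cvec (eigenprojector M \<theta> u)
          - \<gamma> *s cvec (eigenprojector M \<theta> v) = 0"
        by (simp add: cvec_def vec_eq_iff)
    qed
  qed (use Lambda_eigenvalue in auto)
  also have "\<dots> = (\<Sum>\<theta>\<in>Lp \<union> Lm. (cis (- t * \<theta>) - \<gamma> * cis (phase \<theta>)) *s cvec (eigenprojector M \<theta> u))"
    by (intro sum.cong refl)
      (simp add: eigenprojector_phase cvec_scaleR cis_phase vector_smult_assoc vec.scale_left_diff_distrib)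
  finally have "norm (transition_matrix M t *v cvec u - \<gamma> *s cvec v)
      \<le> (\<Sum>\<theta>\<in>Lp \<union> Lm. norm (cis (- t * \<theta>) - \<gamma> * cis (phase \<theta>)) * norm (eigenprojector M \<theta> u))"
    by (simp only:) (rule sum_norm_le, simp only: norm_vector_scalar_mult norm_cvec order.refl)
  also have "\<dots> \<le> (\<Sum>\<theta>\<in>Lp \<union> Lm. \<delta> * norm (eigenprojector M \<theta> u))"
    by (intro sum_mono mult_right_mono assms(2)) auto
  finally show ?thesis by (simp add: sum_distrib_left)
qed

text \<open>Kronecker approximation at the frequency differences supplies the time, and the global
  phase is then read off at a base eigenvalue.\<close>

lemma transfer_sufficient:
  assumes sc: "strongly_cospectral M u v"
    and even: "\<And>k::real \<Rightarrow> int. (\<Sum>\<theta>\<in>Lp \<union> Lm. of_int (k \<theta>) * \<theta>) = 0 \<Longrightarrow>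
      (\<Sum>\<theta>\<in>Lp \<union> Lm. k \<theta>) = 0 \<Longrightarrow> even (\<Sum>y\<in>Lm. k y)"
  shows "pretty_good_transfer M u v"
  unfolding pretty_good_transfer_def
proof (intro allI impI)
  fix \<epsilon> :: real assume "\<epsilon> > 0"
  define C where "C = (\<Sum>\<theta>\<in>Lp \<union> Lm. norm (eigenprojector M \<theta> u))"
  have "C \<ge> 0" by (simp add: C_def sum_nonneg)
  \<comment> \<open>The summand 1 avoids division by 0 and leaves the strict slack in
    \<open>\<delta> * C < \<epsilon>\<close>.\<close>
  define \<delta> where "\<delta> = \<epsilon> / (C + 1)"
  have \<delta>: "\<delta> > 0" "\<delta> * C < \<epsilon>"
    using \<open>\<epsilon> > 0\<close> \<open>C \<ge> 0\<close> by (simp_all add: \<delta>_def divide_simps)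
  have "\<exists>t \<gamma>. norm \<gamma> = 1 \<and> (\<forall>\<theta>\<in>Lp \<union> Lm. norm (cis (- t * \<theta>) - \<gamma> * cis (phase \<theta>)) \<le> \<delta>)"
  proof (cases "Lp \<union> Lm = {}")
    case True
    then show ?thesis by (auto intro: exI[of _ 1])
  next
    case False
    then obtain \<theta>\<^sub>0 where \<theta>\<^sub>0: "\<theta>\<^sub>0 \<in> Lp \<union> Lm" by blast
    \<comment> \<open>Phases in full turns, since Kronecker approximation is modulo
      integers.\<close>
    define \<alpha> where "\<alpha> \<theta> = phase \<theta> / (2 * pi)" for \<theta>
    have "(\<Sum>\<theta>\<in>Lp \<union> Lm. of_int (k \<theta>) * (\<alpha> \<theta> - \<alpha> \<theta>\<^sub>0)) \<in> \<int>"
      if rel: "(\<Sum>\<theta>\<in>Lp \<union> Lm. of_int (k \<theta>) * (\<theta> - \<theta>\<^sub>0)) = 0" for k :: "real \<Rightarrow> int"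
    proof -
      \<comment> \<open>The coefficient at \<open>\<theta>\<^sub>0\<close> is free, because its
        frequency difference is 0; adjusting it makes the total 0, as the parity hypothesis
        demands.\<close>
      define k' where "k' = k(\<theta>\<^sub>0 := k \<theta>\<^sub>0 - (\<Sum>\<theta>\<in>Lp \<union> Lm. k \<theta>))"
      have k': "(\<Sum>\<theta>\<in>Lp \<union> Lm. of_int (k' \<theta>) * f \<theta>) = (\<Sum>\<theta>\<in>Lp \<union> Lm. of_int (k \<theta>) * (f \<theta> - f \<theta>\<^sub>0))"
        for f :: "real \<Rightarrow> real"
      proof -
        have "(\<Sum>\<theta>\<in>Lp \<union> Lm. of_int (k' \<theta>) * f \<theta>)
            = (\<Sum>\<theta>\<in>Lp \<union> Lm. of_int (k \<theta>) * f \<theta>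
                - (if \<theta> = \<theta>\<^sub>0 then of_int (\<Sum>\<theta>\<in>Lp \<union> Lm. k \<theta>) * f \<theta>\<^sub>0 else 0))"
          by (intro sum.cong) (auto simp: k'_def left_diff_distrib)
        also have "\<dots> = (\<Sum>\<theta>\<in>Lp \<union> Lm. of_int (k \<theta>) * f \<theta>) - of_int (\<Sum>\<theta>\<in>Lp \<union> Lm. k \<theta>) * f \<theta>\<^sub>0"
          using \<theta>\<^sub>0 finite_Lambda by (simp add: sum_subtractf)
        finally show ?thesis by (simp add: right_diff_distrib sum_subtractf sum_distrib_right)
      qed
      have "real_of_int (\<Sum>\<theta>\<in>Lp \<union> Lm. k' \<theta>) = 0"
        using k'[of "\<lambda>_. 1"] by simp
      then have "(\<Sum>\<theta>\<in>Lp \<union> Lm. k' \<theta>) = 0" by (simp only: of_int_eq_0_iff)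
      moreover have "(\<Sum>\<theta>\<in>Lp \<union> Lm. of_int (k' \<theta>) * \<theta>) = 0"
        using k'[of "\<lambda>x. x"] rel by simp
      ultimately obtain z where z: "(\<Sum>y\<in>Lm. k' y) = 2 * z"
        using even[of k'] by (auto elim: evenE)
      have "(\<Sum>\<theta>\<in>Lp \<union> Lm. of_int (k' \<theta>) * \<alpha> \<theta>) = (\<Sum>\<theta>\<in>Lp \<union> Lm. of_int (k' \<theta>) * phase \<theta>) / (2 * pi)"
        by (simp add: \<alpha>_def sum_divide_distrib)
      also have "\<dots> = of_int z" by (simp add: sum_phase z del: of_int_sum)
      finally show ?thesis by (simp add: k')
    qed
    then obtain t h where
      th: "\<And>\<theta>. \<theta> \<in> Lp \<union> Lm \<Longrightarrow>
        \<bar>t * (\<theta> - \<theta>\<^sub>0) - of_int (h \<theta>) - (\<alpha> \<theta> - \<alpha> \<theta>\<^sub>0)\<bar> < \<delta> / (2 * pi)"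
      using Kronecker_dependent[of "Lp \<union> Lm" "\<delta> / (2 * pi)" "\<lambda>\<theta>. \<theta> - \<theta>\<^sub>0" "\<lambda>\<theta>. \<alpha> \<theta> - \<alpha> \<theta>\<^sub>0"]
        finite_Lambda \<delta>(1) by auto
    \<comment> \<open>Chosen so that the error at \<open>\<theta>\<^sub>0\<close> would be 0 for the
      time \<open>- 2 * pi * t\<close>, which converts turns to radians and offsets the minus sign
      in the evolution.\<close>
    define \<gamma> where "\<gamma> = cis (2 * pi * (t * \<theta>\<^sub>0 - \<alpha> \<theta>\<^sub>0))"
    have "norm (cis (- (- 2 * pi * t) * \<theta>) - \<gamma> * cis (phase \<theta>)) \<le> \<delta>" if \<theta>: "\<theta> \<in> Lp \<union> Lm" for \<theta>
    proof -
      define r where "r = t * (\<theta> - \<theta>\<^sub>0) - of_int (h \<theta>) - (\<alpha> \<theta> - \<alpha> \<theta>\<^sub>0)"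
      define y where "y = 2 * pi * (t * \<theta>\<^sub>0 - \<alpha> \<theta>\<^sub>0) + phase \<theta>"
      \<comment> \<open>The integer \<open>h \<theta>\<close> counts full turns, invisible to
        \<open>cis\<close>; only the Kronecker error \<open>r\<close> remains.\<close>
      have "2 * pi * t * \<theta> = (y + 2 * pi * r) + 2 * pi * of_int (h \<theta>)"
        by (simp add: r_def y_def \<alpha>_def field_simps)
      then have "cis (- (- 2 * pi * t) * \<theta>) = cis (y + 2 * pi * r)"
        by (simp flip: cis_mult)
      moreover have "\<gamma> * cis (phase \<theta>) = cis y" by (simp add: \<gamma>_def y_def cis_mult)
      ultimately have "norm (cis (- (- 2 * pi * t) * \<theta>) - \<gamma> * cis (phase \<theta>)) \<le> \<bar>2 * pi * r\<bar>"
        using norm_cis_diff_le[of "y + 2 * pi * r" y] by simp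
      also have "\<dots> \<le> \<delta>"
      proof -
        have "\<bar>r\<bar> < \<delta> / (2 * pi)" using th[OF \<theta>] by (simp add: r_def)
        then show ?thesis by (simp add: abs_mult pos_less_divide_eq mult.commute)
      qed
      finally show ?thesis .
    qed
    moreover have "norm \<gamma> = 1" by (simp add: \<gamma>_def)
    ultimately show ?thesis by blast
  qed
  then obtain t \<gamma> where "norm \<gamma> = 1"
    and "\<And>\<theta>. \<theta> \<in> Lp \<union> Lm \<Longrightarrow> norm (cis (- t * \<theta>) - \<gamma> * cis (phase \<theta>)) \<le> \<delta>"
    by blast
  then show "\<exists>\<tau> \<gamma>. norm \<gamma> = 1 \<and> norm (transition_matrix M \<tau> *v cvec u - \<gamma> *s cvec v) < \<epsilon>"
    using transfer_error_le[OF sc, of t \<gamma> \<delta>] \<delta>(2) unfolding C_def by (meson le_less_trans)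
qed

theorem pretty_good_transfer_iff:
  "pretty_good_transfer M u v \<longleftrightarrow> strongly_cospectral M u v \<and>
    (\<forall>(l :: real \<Rightarrow> int) (m :: real \<Rightarrow> int).
       (\<Sum>x\<in>Lp. of_int (l x) * x) + (\<Sum>y\<in>Lm. of_int (m y) * y) = 0 \<and>
       (\<Sum>x\<in>Lp. l x) + (\<Sum>y\<in>Lm. m y) = 0
       \<longrightarrow> even (\<Sum>y\<in>Lm. m y))"
  (is "?T \<longleftrightarrow> ?C \<and> ?P")
proof (intro iffI conjI)
  assume T: ?T
  show ?C using transfer_necessary(1)[OF T] .
  show ?P
  proof (intro allI impI)
    fix l m :: "real \<Rightarrow> int"
    assume "(\<Sum>x\<in>Lp. of_int (l x) * x) + (\<Sum>y\<in>Lm. of_int (m y) * y) = 0 \<and>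
      (\<Sum>x\<in>Lp. l x) + (\<Sum>y\<in>Lm. m y) = 0"
    \<comment> \<open>The merged coefficients of \<open>sum_Lambda\<close> form a single relation on
      the union.\<close>
    then have "even (\<Sum>y\<in>Lm. if y \<in> Lm then m y else l y)"
      using sum_Lambda[of "\<lambda>i x. of_int i * x" m l] sum_Lambda[of "\<lambda>i x. i" m l]
      by (intro transfer_necessary(2)[OF T]) auto
    then show "even (\<Sum>y\<in>Lm. m y)" by simp
  qed
next
  assume CP: "?C \<and> ?P"
  have "even (\<Sum>y\<in>Lm. k y)"
    if "(\<Sum>\<theta>\<in>Lp \<union> Lm. of_int (k \<theta>) * \<theta>) = 0" "(\<Sum>\<theta>\<in>Lp \<union> Lm. k \<theta>) = 0" for k :: "real \<Rightarrow> int"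
    using CP[THEN conjunct2, rule_format, of k k] that
    by (simp add: sum.union_disjoint[OF finite_Lambda Lambda_disjoint])
  with CP show ?T by (intro transfer_sufficient) auto
qed

end

section \<open>Pair states of a graph Laplacian\<close>

theorem theorem2p2:
  fixes E :: "'n::finite \<Rightarrow> 'n \<Rightarrow> bool" and a b c d :: 'n
  assumes "symp E" and "irreflp E" and "a \<noteq> b" and "c \<noteq> d"
  defines "L \<equiv> laplacian E"
  defines "Lp \<equiv> Lambda_plus L (pair_vec a b) (pair_vec c d)"
  defines "Lm \<equiv> Lambda_minus L (pair_vec a b) (pair_vec c d)"
  shows "pair_lpgst E a b c d \<longleftrightarrow>
    strongly_cospectral L (pair_vec a b) (pair_vec c d) \<and>
    (\<forall>(l :: real \<Rightarrow> int) (m :: real \<Rightarrow> int).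
       (\<Sum>x\<in>Lp. of_int (l x) * x) + (\<Sum>y\<in>Lm. of_int (m y) * y) = 0 \<and>
       (\<Sum>x\<in>Lp. l x) + (\<Sum>y\<in>Lm. m y) = 0
       \<longrightarrow> even (\<Sum>y\<in>Lm. m y))"
proof -
  interpret symmetric_pair L "pair_vec a b" "pair_vec c d"
    using transpose_laplacian[OF assms(1)] by unfold_locales (simp add: L_def)
  \<comment> \<open>Complexifying a real pair vector gives the complex pair vector, so the two
    notions of transfer coincide.\<close>
  have "pair_lpgst E a b c d \<longleftrightarrow> pretty_good_transfer L (pair_vec a b) (pair_vec c d)"
    by (simp add: pair_lpgst_def pretty_good_transfer_def cvec_pair_vec L_def)
  then show ?thesis
    unfolding pretty_good_transfer_iff Lp_def Lm_def .
qed

end
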